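(* Let $T>0$ and let $u$ be a solution on $(0,T)\times\mathbb{R}$ of $$u_{t}-u_{txx}=4uu_{x}+2u_{x}^{2}+2uu_{xx}-6u_{x}u_{xx}-2uu_{xxx}$$ such that $\|u(t,\cdot)\|_{L^1(\mathbb{R})}$ is invariant (i.e. independent of $t\in(0,T)$). Suppose there exists a (nonempty) open set $\Omega=(T_0,T_1)\times(-\infty,b)\subseteq(0,T)\times\mathbb{R}$, for some $b\in\mathbb{R}$, such that $u$ restricted to $\Omega$ vanishes identically. Then $u\equiv 0$ on $(0,T)\times\mathbb{R}$.
   Context: Standing assumptions on solutions: $u=u(t,x)$ is a real-valued smooth solution on $(0,T)\times\mathbb{R}$ which, together with its derivatives (in particular its first and second order $x$-derivatives), decays to $0$ as $|x|\to\infty$, fast enough that $G\ast u^2$ is well defined and $u$ satisfies the equivalent non-local form $$u_t+u^2-2uu_x=G\ast u^2 \quad\text{on }(0,T)\times\mathbb{R},$$ where $G(x)=(1-\operatorname{sgn}(x))\,g(x)$, $g(x)=\tfrac12 e^{-|x|}$, and $\ast$ denotes convolution in $x$: $(G\ast u^2)(t,x)=\int_{-\infty}^{+\infty}G(x-y)\,u(t,y)^2\,dy$. *)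

theory Defs
  imports "HOL-Analysis.Analysis"
begin

text \<open>Functions of time and space are curried: \<open>u t x\<close>. A solution on the strip \<open>(0,T) \<times> \<real>\<close> is a
  total function of which only the values on the strip matter; the strip is open, so the same
  holds for its partial derivatives there.\<close>

definition dt :: "(real \<Rightarrow> real \<Rightarrow> real) \<Rightarrow> real \<Rightarrow> real \<Rightarrow> real" where
  "dt u t x = deriv (\<lambda>s. u s x) t"

definition dx :: "(real \<Rightarrow> real \<Rightarrow> real) \<Rightarrow> real \<Rightarrow> real \<Rightarrow> real" where
  "dx u t x = deriv (\<lambda>y. u t y) x"

definition strip :: "real \<Rightarrow> (real \<times> real) set" where
  "strip T = {0<..<T} \<times> UNIV"

text \<open>Class \<open>C\<^sup>k\<close> on an open set: all partial derivatives up to order \<open>k\<close> exist there and are jointly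
  continuous. The differentiability clause is needed because \<^const>\<open>deriv\<close> is total.\<close>

primrec Ck_on :: "nat \<Rightarrow> (real \<times> real) set \<Rightarrow> (real \<Rightarrow> real \<Rightarrow> real) \<Rightarrow> bool" where
  "Ck_on 0 S u \<longleftrightarrow> continuous_on S (\<lambda>(t, x). u t x)"
| "Ck_on (Suc k) S u \<longleftrightarrow>
     continuous_on S (\<lambda>(t, x). u t x) \<and>
     (\<forall>(t, x)\<in>S. (\<lambda>s. u s x) differentiable (at t) \<and> (\<lambda>y. u t y) differentiable (at x)) \<and>
     Ck_on k S (dt u) \<and> Ck_on k S (dx u)"

definition smooth_on :: "(real \<times> real) set \<Rightarrow> (real \<Rightarrow> real \<Rightarrow> real) \<Rightarrow> bool" where
  "smooth_on S u \<longleftrightarrow> (\<forall>k. Ck_on k S u)"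

definition satisfies_pde :: "real \<Rightarrow> (real \<Rightarrow> real \<Rightarrow> real) \<Rightarrow> bool" where
  "satisfies_pde T u \<longleftrightarrow> (\<forall>(t, x)\<in>strip T.
     dt u t x - dx (dx (dt u)) t x =
       4 * u t x * dx u t x + 2 * (dx u t x)\<^sup>2 + 2 * u t x * dx (dx u) t x
       - 6 * dx u t x * dx (dx u) t x - 2 * u t x * dx (dx (dx u)) t x)"

definition g :: "real \<Rightarrow> real" where
  "g x = exp (- \<bar>x\<bar>) / 2"

definition G :: "real \<Rightarrow> real" where
  "G x = (1 - sgn x) * g x"

definition convolution :: "(real \<Rightarrow> real) \<Rightarrow> (real \<Rightarrow> real) \<Rightarrow> real \<Rightarrow> real" where
  "convolution f h x = (LINT y|lborel. f (x - y) * h y)"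

definition convolution_defined :: "(real \<Rightarrow> real) \<Rightarrow> (real \<Rightarrow> real) \<Rightarrow> real \<Rightarrow> bool" where
  "convolution_defined f h x \<longleftrightarrow> integrable lborel (\<lambda>y. f (x - y) * h y)"

definition satisfies_nonlocal_form :: "real \<Rightarrow> (real \<Rightarrow> real \<Rightarrow> real) \<Rightarrow> bool" where
  "satisfies_nonlocal_form T u \<longleftrightarrow> (\<forall>(t, x)\<in>strip T.
     convolution_defined G (\<lambda>y. (u t y)\<^sup>2) x \<and>
     dt u t x + (u t x)\<^sup>2 - 2 * u t x * dx u t x = convolution G (\<lambda>y. (u t y)\<^sup>2) x)"

text \<open>By symmetry of mixed derivatives of smooth functions, \<open>dt\<^sup>i dx\<^sup>j u\<close> are all the partial derivatives.\<close>

definition decays :: "real \<Rightarrow> (real \<Rightarrow> real \<Rightarrow> real) \<Rightarrow> bool" where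
  "decays T u \<longleftrightarrow>
     (\<forall>t\<in>{0<..<T}. \<forall>i j. (((dt ^^ i) ((dx ^^ j) u) t) \<longlongrightarrow> 0) at_infinity)"

text \<open>Decaying smooth solutions. That a solution decays fast enough to satisfy the equivalent
  non-local form is part of the notion of solution.\<close>

definition is_solution :: "real \<Rightarrow> (real \<Rightarrow> real \<Rightarrow> real) \<Rightarrow> bool" where
  "is_solution T u \<longleftrightarrow>
     smooth_on (strip T) u \<and> satisfies_pde T u \<and> decays T u \<and> satisfies_nonlocal_form T u"

text \<open>The norm takes the value \<open>\<infinity>\<close> on functions that are not integrable; a Bochner integral would
  wrongly assign them \<open>0\<close>.\<close>

definition L1_norm :: "(real \<Rightarrow> real) \<Rightarrow> ennreal" where
  "L1_norm f = (\<integral>\<^sup>+ x. ennreal \<bar>f x\<bar> \<partial>lborel)"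

end

theory Submission
  imports Defs
begin

text \<open>The kernel \<open>G\<close> is nonnegative and strictly positive on the negative half line, so
  \<open>(G \<ast> u\<^sup>2)(x)\<close> is a positively weighted integral of \<open>u\<^sup>2\<close> over \<open>[x, \<infinity>)\<close>. On \<open>\<Omega>\<close> the left-hand side
  of the non-local equation \<open>u\<^sub>t + u\<^sup>2 - 2 u u\<^sub>x = G \<ast> u\<^sup>2\<close> vanishes: \<open>u\<close> is zero there, and so is
  \<open>u\<^sub>t\<close>, because \<open>\<Omega>\<close> is open in time. Evaluating the equation at a single point \<open>(t, x)\<close> of \<open>\<Omega>\<close> therefore
  kills \<open>u t\<close> on \<open>(x, \<infinity>)\<close> (lemma \<open>zero_right_of_convolution_zero\<close>); as \<open>\<Omega>\<close> reaches \<open>-\<infinity>\<close> in space,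
  \<open>u t\<close> already vanishes on the remaining half line. So one time slice is zero and has \<open>L\<^sup>1\<close> norm \<open>0\<close>;
  conservation of the norm carries this to every other time slice, and a continuous function with
  \<open>L\<^sup>1\<close> norm \<open>0\<close> is zero.\<close>

lemma continuous_on_slice:
  assumes "smooth_on (strip T) u" "t \<in> {0<..<T}"
  shows "continuous_on UNIV (u t)"
proof -
  have "continuous_on (strip T) (\<lambda>(t, x). u t x)"
    using assms(1) by (auto simp: smooth_on_def dest: spec[of _ 0])
  then have "continuous_on UNIV (\<lambda>x. case (t, x) of (t, x) \<Rightarrow> u t x)"
    by (rule continuous_on_compose2) (use assms(2) in \<open>auto simp: strip_def intro!: continuous_intros\<close>)
  then show ?thesis
    by simp
qed

lemma continuous_AE_zero_on_open:
  fixes f :: "real \<Rightarrow> real"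
  assumes "continuous_on UNIV f" "open S" "AE y in lborel. y \<in> S \<longrightarrow> f y = 0" "x \<in> S"
  shows "f x = 0"
proof -
  have "closed {y. f y = 0}"
    using assms(1) by (intro closed_Collect_eq) auto
  moreover have "AE y in lebesgue. y \<in> S \<longrightarrow> y \<in> {y. f y = 0}"
    using assms(3) by (auto intro: AE_completion)
  ultimately have "x \<in> {y. f y = 0}"
    using assms(2,4) by (intro mem_closed_if_AE_lebesgue_open[of S "{y. f y = 0}" x])
  then show ?thesis
    by simp
qed

lemma L1_norm_zero_imp_zero:
  assumes "continuous_on UNIV f" "L1_norm f = 0"
  shows "f x = 0"
proof -
  have [measurable]: "f \<in> borel_measurable borel"
    using assms(1) by (rule borel_measurable_continuous_onI)
  have "AE y in lborel. ennreal \<bar>f y\<bar> = 0"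
    using assms(2) unfolding L1_norm_def by (subst (asm) nn_integral_0_iff_AE) auto
  then have "AE y in lborel. y \<in> UNIV \<longrightarrow> f y = 0"
    by eventually_elim simp
  then show ?thesis
    using assms(1) by (intro continuous_AE_zero_on_open[where S = UNIV]) auto
qed

lemma G_nonneg: "0 \<le> G z"
  by (simp add: G_def g_def sgn_if)

lemma G_pos_of_neg: "z < 0 \<Longrightarrow> 0 < G z"
  by (simp add: G_def g_def)

text \<open>The integrand of \<open>(G \<ast> f\<^sup>2)(x)\<close> is nonnegative, so it vanishes almost everywhere as soon as its
  integral does, and the weight \<open>G (x - y)\<close> can be divided out where \<open>y > x\<close>.\<close>

lemma zero_right_of_convolution_zero:
  assumes "continuous_on UNIV f"
    and "convolution_defined G (\<lambda>y. (f y)\<^sup>2) x"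
    and "convolution G (\<lambda>y. (f y)\<^sup>2) x = 0"
    and "x < y"
  shows "f y = 0"
proof (rule continuous_AE_zero_on_open[where f = f and S = "{x<..}"])
  have "AE z in lborel. G (x - z) * (f z)\<^sup>2 = 0"
    using assms(2,3) unfolding convolution_defined_def convolution_def
    by (subst (asm) integral_nonneg_eq_0_iff_AE) (auto simp: G_nonneg)
  then show "AE z in lborel. z \<in> {x<..} \<longrightarrow> f z = 0"
  proof eventually_elim
    case (elim z)
    then show ?case
      using G_pos_of_neg[of "x - z"] by auto
  qed
qed (use assms in auto)

theorem corollary4p1:
  fixes T T\<^sub>0 T\<^sub>1 b :: real
    and u :: "real \<Rightarrow> real \<Rightarrow> real"
    and \<Omega> :: "(real \<times> real) set"
  assumes "T > 0"
    and "is_solution T u"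
    and "\<forall>s\<in>{0<..<T}. \<forall>t\<in>{0<..<T}. L1_norm (u s) = L1_norm (u t)"
    and "\<Omega> = {T\<^sub>0<..<T\<^sub>1} \<times> {..<b}"
    and "\<Omega> \<noteq> {}"
    and "\<Omega> \<subseteq> strip T"
    and "\<forall>(t, x)\<in>\<Omega>. u t x = 0"
  shows "\<forall>(t, x)\<in>strip T. u t x = 0"
proof -
  obtain t x where tx: "(t, x) \<in> \<Omega>"
    using assms(5) by auto
  then have t: "t \<in> {T\<^sub>0<..<T\<^sub>1}" and x: "x < b" and tT: "t \<in> {0<..<T}" and strip: "(t, x) \<in> strip T"
    using subsetD[OF assms(6) tx] assms(4) by (auto simp: strip_def)
  have zero: "u s y = 0" if "s \<in> {T\<^sub>0<..<T\<^sub>1}" "y < b" for s y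
    using that assms(4,7) by auto
  have cont: "continuous_on UNIV (u s)" if "s \<in> {0<..<T}" for s
    using that assms(2) by (auto simp: is_solution_def intro: continuous_on_slice)

  have "\<forall>\<^sub>F s in nhds t. u s x = 0"
    using zero x by (intro eventually_nhds_in_open[OF open_greaterThanLessThan t, THEN eventually_mono]) auto
  then have "dt u t x = 0"
    unfolding dt_def by (subst deriv_cong_ev[where g = "\<lambda>_. 0"]) auto
  then have "convolution G (\<lambda>y. (u t y)\<^sup>2) x = 0" "convolution_defined G (\<lambda>y. (u t y)\<^sup>2) x"
    using assms(2) strip zero[OF t x]
    by (auto simp: is_solution_def satisfies_nonlocal_form_def)
  then have "u t y = 0" if "x < y" for y
    using zero_right_of_convolution_zero[OF cont[OF tT]] that by blast
  then have "u t y = 0" for y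
    using zero[OF t, of y] x by (cases "x < y") auto
  then have "L1_norm (u t) = 0"
    by (simp add: L1_norm_def)
  then have "L1_norm (u s) = 0" if "s \<in> {0<..<T}" for s
    using assms(3) that tT by metis
  then show ?thesis
    using L1_norm_zero_imp_zero[OF cont] by (auto simp: strip_def)
qed

end
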